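(* For every integer $\ell \ge 1$, $$\left(1+\frac{1}{\ell}\right)^{-\ell} \;\le\; \frac{1}{e}\,\exp\!\left(\frac{1}{2\ell} - \frac{1}{3\ell^2} + \frac{1}{4\ell^3}\right).$$ Moreover, the right-hand side, expanded as an asymptotic series in $1/\ell$, agrees with $(1+1/\ell)^{-\ell}$ through order $\ell^{-3}$; that is, as $\ell \to \infty$, both $$\frac{1}{e}\exp\!\left(\frac{1}{2\ell} - \frac{1}{3\ell^2} + \frac{1}{4\ell^3}\right) \;=\; \frac{1}{e}\left(1 + \frac{1}{2\ell} - \frac{5}{24\ell^2} + \frac{5}{48\ell^3} + O(\ell^{-4})\right)$$ and $$\left(1+\frac{1}{\ell}\right)^{-\ell} \;=\; \frac{1}{e}\left(1 + \frac{1}{2\ell} - \frac{5}{24\ell^2} + \frac{5}{48\ell^3} + O(\ell^{-4})\right).$$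
   Context: Here $e$ is the base of the natural logarithm, and $O(\ell^{-4})$ denotes a function of $\ell$ whose absolute value is at most $C\ell^{-4}$ for some constant $C$ and all sufficiently large $\ell$. *)

theory Defs
  imports Complex_Main "HOL-Library.Landau_Symbols"
begin

end

theory Submission
  imports Defs "HOL-Real_Asymp.Real_Asymp"
begin

text \<open>Write the power as \<open>exp (- l * ln (1 + 1/l))\<close>. For \<open>x \<ge> 0\<close>
  the degree-4 Taylor polynomial of \<open>ln (1 + x)\<close> is a lower bound
  (\<open>ln_one_plus_ge_taylor4\<close>); multiplied by \<open>- l\<close> at
  \<open>x = 1/l\<close> it becomes exactly -1 plus the exponent of the right-hand side, which gives
  the inequality. The next Taylor term of the logarithm changes the exponent only by O(l^-4), so
  both sides share their expansion through order l^-3. The two expansions are verified separately,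
  each after factoring out \<open>1 / exp 1\<close>.\<close>

text \<open>The difference of the two sides vanishes at 0 and has derivative
  \<open>t ^ 4 / (1 + t)\<close>, which is nonnegative on \<open>t \<ge> 0\<close>.\<close>

lemma ln_one_plus_ge_taylor4:
  fixes x :: real
  assumes "x \<ge> 0"
  shows "x - x ^ 2 / 2 + x ^ 3 / 3 - x ^ 4 / 4 \<le> ln (1 + x)"
proof -
  define f where "f = (\<lambda>t::real. ln (1 + t) - (t - t ^ 2 / 2 + t ^ 3 / 3 - t ^ 4 / 4))"
  have "f 0 \<le> f x"
  proof (rule DERIV_nonneg_imp_nondecreasing[OF assms])
    fix t :: real
    assume "0 \<le> t" "t \<le> x"
    have "(f has_real_derivative 1 / (1 + t) - (1 - t + t ^ 2 - t ^ 3)) (at t)"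
      unfolding f_def using \<open>0 \<le> t\<close> by (auto intro!: derivative_eq_intros)
    \<comment> \<open>Finite geometric sum:
      \<open>1 - t + t ^ 2 - t ^ 3 = (1 - t ^ 4) / (1 + t)\<close>.\<close>
    moreover have "1 / (1 + t) - (1 - t + t ^ 2 - t ^ 3) = t ^ 4 / (1 + t)"
      using \<open>0 \<le> t\<close> by (simp add: field_simps eval_nat_numeral)
    ultimately show "\<exists>y. (f has_real_derivative y) (at t) \<and> 0 \<le> y"
      using \<open>0 \<le> t\<close> by auto
  qed
  then show ?thesis by (simp add: f_def)
qed

text \<open>Moves the varying exponent onto a logarithm, where both the Taylor bound and the
  asymptotic expansion apply.\<close>

lemma one_plus_inverse_powi_eq_exp:
  fixes l :: nat
  assumes "l \<ge> 1"
  shows "(1 + 1 / real l) powi (- int l) = exp (- (real l * ln (1 + 1 / real l)))"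
proof -
  have "1 + 1 / real l > 0"
    by (simp add: add_pos_nonneg)
  then show ?thesis
    by (simp add: power_int_minus exp_minus exp_of_nat_mult)
qed

lemma one_plus_inverse_powi_le:
  fixes l :: nat
  assumes "l \<ge> 1"
  shows "(1 + 1 / real l) powi (- int l)
    \<le> (1 / exp 1) * exp (1 / (2 * real l) - 1 / (3 * real l ^ 2) + 1 / (4 * real l ^ 3))"
proof -
  define x where "x = 1 / real l"
  have x: "x \<ge> 0" "real l * x = 1"
    using assms by (auto simp: x_def)
  have "real l * (x - x ^ 2 / 2 + x ^ 3 / 3 - x ^ 4 / 4) \<le> real l * ln (1 + x)"
    by (intro mult_left_mono ln_one_plus_ge_taylor4 x) simp
  \<comment> \<open>Splitting off one factor \<open>x\<close> pairs it with \<open>real l\<close>,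
    and \<open>real l * x = 1\<close> turns the leading term into the constant that yields
    \<open>1 / exp 1\<close>.\<close>
  also have "real l * (x - x ^ 2 / 2 + x ^ 3 / 3 - x ^ 4 / 4)
      = (real l * x) * (1 - x / 2 + x ^ 2 / 3 - x ^ 3 / 4)"
    by (simp add: algebra_simps eval_nat_numeral)
  finally have "- (real l * ln (1 + x)) \<le> - 1 + (x / 2 - x ^ 2 / 3 + x ^ 3 / 4)"
    using x by simp
  then have "exp (- (real l * ln (1 + x))) \<le> exp (- 1) * exp (x / 2 - x ^ 2 / 3 + x ^ 3 / 4)"
    by (simp flip: exp_add)
  then show ?thesis
    using assms
    by (simp add: one_plus_inverse_powi_eq_exp x_def power_divide exp_minus inverse_eq_divide mult.commute)
qed

theorem theorem4:
  shows "(\<forall>l::nat. l \<ge> 1 \<longrightarrow>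
            (1 + 1 / real l) powi (- int l)
              \<le> (1 / exp 1) * exp (1 / (2 * real l) - 1 / (3 * real l ^ 2) + 1 / (4 * real l ^ 3)))
       \<and> (\<exists>g :: nat \<Rightarrow> real. g \<in> O(\<lambda>l. 1 / real l ^ 4) \<and>
            (\<forall>l\<ge>1. (1 / exp 1) * exp (1 / (2 * real l) - 1 / (3 * real l ^ 2) + 1 / (4 * real l ^ 3))
               = (1 / exp 1) * (1 + 1 / (2 * real l) - 5 / (24 * real l ^ 2) + 5 / (48 * real l ^ 3) + g l)))
       \<and> (\<exists>h :: nat \<Rightarrow> real. h \<in> O(\<lambda>l. 1 / real l ^ 4) \<and>
            (\<forall>l\<ge>1. (1 + 1 / real l) powi (- int l)
               = (1 / exp 1) * (1 + 1 / (2 * real l) - 5 / (24 * real l ^ 2) + 5 / (48 * real l ^ 3) + h l)))"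
proof (intro conjI)
  let ?T = "\<lambda>l::nat. 1 + 1 / (2 * real l) - 5 / (24 * real l ^ 2) + 5 / (48 * real l ^ 3)"
  show "\<forall>l::nat. l \<ge> 1 \<longrightarrow> (1 + 1 / real l) powi (- int l)
      \<le> (1 / exp 1) * exp (1 / (2 * real l) - 1 / (3 * real l ^ 2) + 1 / (4 * real l ^ 3))"
    using one_plus_inverse_powi_le by blast
  \<comment> \<open>This difference is the witness \<open>g\<close>: with it the required equation
    is an identity, and only its order of growth needs proof.\<close>
  have "(\<lambda>l::nat. exp (1 / (2 * real l) - 1 / (3 * real l ^ 2) + 1 / (4 * real l ^ 3)) - ?T l)
      \<in> O(\<lambda>l. 1 / real l ^ 4)"
    by real_asymp
  then show "\<exists>g :: nat \<Rightarrow> real. g \<in> O(\<lambda>l. 1 / real l ^ 4) \<and>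
      (\<forall>l\<ge>1. (1 / exp 1) * exp (1 / (2 * real l) - 1 / (3 * real l ^ 2) + 1 / (4 * real l ^ 3))
         = (1 / exp 1) * (?T l + g l))"
    by (intro exI conjI) auto
  \<comment> \<open>The summand 1 in the exponent is the factor \<open>exp 1\<close> that cancels
    \<open>1 / exp 1\<close>; the exponent then tends to 0, and the difference serves as
    \<open>h\<close>.\<close>
  have "(\<lambda>l::nat. exp (1 - real l * ln (1 + 1 / real l)) - ?T l) \<in> O(\<lambda>l. 1 / real l ^ 4)"
    by real_asymp
  then show "\<exists>h :: nat \<Rightarrow> real. h \<in> O(\<lambda>l. 1 / real l ^ 4) \<and>
      (\<forall>l\<ge>1. (1 + 1 / real l) powi (- int l) = (1 / exp 1) * (?T l + h l))"
    by (intro exI conjI) (auto simp: one_plus_inverse_powi_eq_exp exp_diff exp_minus inverse_eq_divide)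
qed

end
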